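(* Let $K = \{p_1, \ldots, p_n\} \subset \mathbb{R}^d$ be a finite set of $n$ points affinely spanning $\mathbb{R}^d$, and let $q$ be a point in the interior of $\operatorname{conv}(K)$. Then there exists a projective transformation $\phi \colon \mathbb{R}\mathrm{P}^d \to \mathbb{R}\mathrm{P}^d$, admissible with respect to $K$, such that \[ \frac{\phi(p_1) + \cdots + \phi(p_n)}{n} = \phi(q). \] Moreover, if $\psi$ is any other projective transformation, admissible with respect to $K$, with $\frac{1}{n}\sum_{i=1}^n \psi(p_i) = \psi(q)$, then $\phi \circ \psi^{-1}$ is an affine transformation.
   Context: $\mathbb{R}^d$ is identified with the affine chart $\{(x_0 : x_1 : \cdots : x_d) \mid x_0 \neq 0\}$ of $\mathbb{R}\mathrm{P}^d$ via $x \mapsto (1 : x)$. A projective transformation $\phi$ of $\mathbb{R}\mathrm{P}^d$ is called admissible for (with respect to) a set $K \subset \mathbb{R}^d$ if $\phi(\operatorname{conv}(K)) \subset \mathbb{R}^d$. A projective transformation is affine if it restricts to a map $x \mapsto Ax+b$ of $\mathbb{R}^d$ with $A \in \mathrm{GL}(d)$, $b \in \mathbb{R}^d$. *)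

theory Defs
  imports "HOL-Analysis.Analysis"
begin

definition same_line :: "real \<times> (real ^ 'd) \<Rightarrow> real \<times> (real ^ 'd) \<Rightarrow> bool" where
  "same_line v w \<longleftrightarrow> v \<noteq> 0 \<and> w \<noteq> 0 \<and> (\<exists>c. c \<noteq> 0 \<and> w = c *\<^sub>R v)"

lemma part_equivp_same_line: "part_equivp same_line"
proof (rule part_equivpI)
  show "\<exists>v :: real \<times> (real ^ 'd). same_line v v"
    by (rule exI[of _ "(1, 0)"]) (auto simp: same_line_def zero_prod_def intro: exI[of _ 1])
  show "symp (same_line :: real \<times> (real ^ 'd) \<Rightarrow> _)"
  proof (rule sympI)
    fix v w :: "real \<times> (real ^ 'd)"
    assume "same_line v w"
    then obtain c where c: "v \<noteq> 0" "w \<noteq> 0" "c \<noteq> 0" "w = c *\<^sub>R v"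
      by (auto simp: same_line_def)
    then have "v = inverse c *\<^sub>R w"
      by simp
    with c show "same_line w v"
      unfolding same_line_def by (metis inverse_nonzero_iff_nonzero)
  qed
  show "transp (same_line :: real \<times> (real ^ 'd) \<Rightarrow> _)"
  proof (rule transpI)
    fix u v w :: "real \<times> (real ^ 'd)"
    assume "same_line u v" "same_line v w"
    then obtain a b where "u \<noteq> 0" "w \<noteq> 0" "a \<noteq> 0" "b \<noteq> 0" "v = a *\<^sub>R u" "w = b *\<^sub>R v"
      by (auto simp: same_line_def)
    then show "same_line u w"
      unfolding same_line_def by (intro conjI exI[of _ "b * a"]) auto
  qed
qed

(* The type 'd rproj is the real projective space of dimension CARD('d): nonzero vectors
   (x_0, x) of R x R^d up to nonzero scaling. *)
quotient_type (overloaded) 'd rproj =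
  "real \<times> (real ^ ('d :: finite))" / partial: same_line
  by (rule part_equivp_same_line)

(* The point with given homogeneous coordinates; only meaningful for nonzero vectors. *)
definition hpoint :: "real \<times> (real ^ 'd) \<Rightarrow> 'd rproj" where
  "hpoint v = abs_rproj v"

lemma hpoint_eq_iff:
  assumes "v \<noteq> 0" "w \<noteq> 0"
  shows "hpoint v = hpoint w \<longleftrightarrow> (\<exists>c. c \<noteq> 0 \<and> w = c *\<^sub>R v)"
proof -
  have refl: "same_line u u" if "u \<noteq> 0" for u :: "real \<times> (real ^ 'd)"
    using that by (auto simp: same_line_def intro: exI[of _ 1])
  have "hpoint v = hpoint w \<longleftrightarrow> same_line v w"
    unfolding hpoint_def using Quotient_rel[OF Quotient_rproj, of v w] refl assms by blast
  with assms show ?thesis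
    by (simp add: same_line_def)
qed

lemma hpoint_cases:
  obtains v where "v \<noteq> 0" "P = hpoint v"
proof -
  have "same_line (rep_rproj P) (rep_rproj P)" "abs_rproj (rep_rproj P) = P"
    using Quotient_rep_reflp[OF Quotient_rproj] Quotient_abs_rep[OF Quotient_rproj] by auto
  then show thesis
    using that[of "rep_rproj P"] by (auto simp: same_line_def hpoint_def)
qed

definition affine_embed :: "real ^ 'd \<Rightarrow> 'd rproj" where
  "affine_embed x = hpoint (1, x)"

lemma inj_affine_embed: "inj affine_embed"
  by (rule injI) (auto simp: affine_embed_def hpoint_eq_iff zero_prod_def)

(* Inverse of the identification of R^d with the chart x_0 nonzero;
   only meaningful on range affine_embed. *)
definition affine_coords :: "'d rproj \<Rightarrow> real ^ 'd" where
  "affine_coords = inv affine_embed"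

definition projective_transformation :: "('d::finite rproj \<Rightarrow> 'd rproj) \<Rightarrow> bool" where
  "projective_transformation \<phi> \<longleftrightarrow>
     (\<exists>f :: real \<times> (real ^ 'd) \<Rightarrow> real \<times> (real ^ 'd).
        linear f \<and> bij f \<and> (\<forall>v. v \<noteq> 0 \<longrightarrow> \<phi> (hpoint v) = hpoint (f v)))"

definition admissible :: "('d::finite rproj \<Rightarrow> 'd rproj) \<Rightarrow> (real ^ 'd) set \<Rightarrow> bool" where
  "admissible \<phi> K \<longleftrightarrow> \<phi> ` affine_embed ` (convex hull K) \<subseteq> range affine_embed"

definition affine_transformation :: "('d::finite rproj \<Rightarrow> 'd rproj) \<Rightarrow> bool" where
  "affine_transformation \<phi> \<longleftrightarrow> projective_transformation \<phi> \<and>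
     (\<exists>(A :: real ^ 'd ^ 'd) b. invertible A \<and> (\<forall>x. \<phi> (affine_embed x) = affine_embed (A *v x + b)))"

lemma range_affine_embed: "range affine_embed = {hpoint (x0, x) | x0 x. x0 \<noteq> 0}"
proof -
  have "hpoint (x0, x) = affine_embed (x /\<^sub>R x0)" if "x0 \<noteq> 0" for x0 and x :: "real ^ 'd"
    using that by (auto simp: affine_embed_def hpoint_eq_iff zero_prod_def intro!: exI[of _ "inverse x0"])
  then show ?thesis
    by (auto simp: affine_embed_def)
qed

lemma bij_projective_transformation:
  assumes "projective_transformation \<phi>"
  shows "bij \<phi>"
proof -
  obtain f where f: "linear f" "bij f" "\<And>v. v \<noteq> 0 \<Longrightarrow> \<phi> (hpoint v) = hpoint (f v)"
    using assms by (auto simp: projective_transformation_def)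
  have nz: "f v \<noteq> 0 \<longleftrightarrow> v \<noteq> 0" for v
    using f(1,2) by (metis bij_pointE linear_0)
  have "inj \<phi>"
  proof (rule injI)
    fix P Q assume eq: "\<phi> P = \<phi> Q"
    obtain v w where vw: "v \<noteq> 0" "P = hpoint v" "w \<noteq> 0" "Q = hpoint w"
      by (metis hpoint_cases)
    then obtain c where c: "c \<noteq> 0" "f w = c *\<^sub>R f v"
      using eq f(3) nz hpoint_eq_iff[of "f v" "f w"] by auto
    then have "w = c *\<^sub>R v"
      using f(1,2) by (metis bij_is_inj injD linear_cmul)
    with c vw show "P = Q"
      by (auto simp: hpoint_eq_iff)
  qed
  moreover have "\<exists>P. Q = \<phi> P" for Q
  proof -
    obtain w where w: "w \<noteq> 0" "Q = hpoint w"
      by (rule hpoint_cases)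
    obtain v where "w = f v"
      using f(2) by (metis bij_pointE)
    with w nz f(3) show ?thesis
      by metis
  qed
  ultimately show ?thesis
    by (auto simp: bij_def surj_def)
qed

end

theory Submission imports Defs begin

text \<open>
  Let a projective transformation be induced by a linear bijection \<open>f\<close> of
  \<open>\<real> \<times> \<real>\<^sup>d\<close>. In the affine chart it sends \<open>x\<close> to \<open>snd (f (1, x)) / l x\<close> with
  \<open>l x = fst (f (1, x))\<close>, and admissibility says that the affine function \<open>l\<close> has no zero on
  the convex hull of \<open>K\<close>. Lifting the points back to \<open>\<real> \<times> \<real>\<^sup>d\<close> and cancelling \<open>f\<close> shows that
  the image of \<open>q\<close> is the centroid of the images of \<open>K\<close> iff
  \<open>(\<Sum>p\<in>K. (1, p) /\<^sub>R l p) = card K *\<^sub>R (1, q) /\<^sub>R l q\<close>, so only the hyperplane \<open>l = 0\<close> that is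
  sent to infinity matters. Normalised by \<open>l q = 1\<close>, this function is
  \<open>l x = 1 + a \<bullet> (x - q)\<close> for some vector \<open>a\<close>, it is positive on \<open>K\<close>, and the condition becomes
  \<open>(\<Sum>p\<in>K. (p - q) /\<^sub>R (1 + a \<bullet> (p - q))) = 0\<close>.

  This says that \<open>a\<close> is a critical point of the strictly concave function
  \<open>\<lambda>a. \<Sum>p\<in>K. ln (1 + a \<bullet> (p - q))\<close>. Its domain is the interior of the polytope given by
  \<open>1 + a \<bullet> (p - q) \<ge> 0\<close> for \<open>p \<in> K\<close>, which is bounded because \<open>q\<close> is an interior point of the
  hull, and the function tends to \<open>-\<infinity>\<close> at the boundary. Hence there is exactly one critical
  point (\<open>centering_vector_exists\<close>, \<open>centering_vector_unique\<close>). Existence of the transformation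
  follows by writing down one that sends the corresponding hyperplane to infinity. Two solutions
  send the same hyperplane to infinity, so their quotient fixes the hyperplane at infinity and
  is affine.
\<close>

section \<open>The centering hyperplane\<close>

definition centering_vector :: "'a::real_inner set \<Rightarrow> 'a \<Rightarrow> 'a \<Rightarrow> bool" where
  "centering_vector K q a \<longleftrightarrow>
     (\<forall>p\<in>K. 0 < 1 + a \<bullet> (p - q)) \<and> (\<Sum>p\<in>K. (p - q) /\<^sub>R (1 + a \<bullet> (p - q))) = 0"

lemma affine_ineq_on_hull:
  fixes a q :: "'a::real_inner"
  assumes "\<And>p. p \<in> K \<Longrightarrow> c \<le> a \<bullet> (p - q)" and "x \<in> convex hull K"
  shows "c \<le> a \<bullet> (x - q)"
proof -
  have "convex {x. a \<bullet> x \<ge> c + a \<bullet> q}"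
    by (rule convex_halfspace_ge)
  moreover have "K \<subseteq> {x. a \<bullet> x \<ge> c + a \<bullet> q}"
    using assms(1) by (auto simp: inner_diff_right algebra_simps)
  ultimately have "convex hull K \<subseteq> {x. a \<bullet> x \<ge> c + a \<bullet> q}"
    by (rule hull_minimal[rotated])
  with assms(2) show ?thesis
    by (auto simp: inner_diff_right algebra_simps)
qed

text \<open>
  Positivity on the finite set \<open>K\<close> gives a positive minimum there, hence positivity on the hull.
\<close>

lemma affine_pos_on_hull:
  fixes a q :: "'a::real_inner"
  assumes "finite K" and "\<And>p. p \<in> K \<Longrightarrow> 0 < 1 + a \<bullet> (p - q)" and "x \<in> convex hull K"
  shows "0 < 1 + a \<bullet> (x - q)"
proof -
  have ne: "K \<noteq> {}"
    using assms(3) by auto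
  define m where "m = Min ((\<lambda>p. a \<bullet> (p - q)) ` K)"
  have "m \<in> (\<lambda>p. a \<bullet> (p - q)) ` K"
    unfolding m_def using assms(1) ne by (intro Min_in) auto
  with assms(2) have "0 < 1 + m"
    by auto
  moreover have "m \<le> a \<bullet> (x - q)"
    by (rule affine_ineq_on_hull[OF _ assms(3)]) (use assms(1) in \<open>simp add: m_def\<close>)
  ultimately show ?thesis
    by linarith
qed

text \<open>
  Walking from \<open>q\<close> by a fixed distance against the direction of \<open>a\<close> stays in the hull, so a long
  \<open>a\<close> would violate one of the inequalities.
\<close>

lemma compact_nonneg_affine:
  fixes K :: "'a::euclidean_space set"
  assumes "q \<in> interior (convex hull K)"
  shows "compact {a. \<forall>p\<in>K. 0 \<le> 1 + a \<bullet> (p - q)}" (is "compact ?D")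
proof -
  obtain e where e: "0 < e" "cball q e \<subseteq> convex hull K"
    using assms mem_interior_cball by blast
  have "norm a \<le> 1 / e" if "a \<in> ?D" for a
  proof (cases "a = 0")
    case False
    define x where "x = q - (e / norm a) *\<^sub>R a"
    have "x \<in> cball q e"
      using False e(1) by (simp add: x_def dist_norm)
    with e(2) have "x \<in> convex hull K"
      by blast
    then have "-1 \<le> a \<bullet> (x - q)"
      by (rule affine_ineq_on_hull[rotated]) (use that in force)
    also have "a \<bullet> (x - q) = - (e * norm a)"
      using False by (simp add: x_def dot_square_norm power2_eq_square)
    finally show ?thesis
      using e(1) by (simp add: field_simps)
  qed (use e in simp)
  then have "bounded ?D"
    by (auto simp: bounded_iff)
  moreover have "closed ?D"
  proof -
    have "?D = (\<Inter>p\<in>K. {a. 0 \<le> 1 + a \<bullet> (p - q)})"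
      by auto
    moreover have "closed (\<Inter>p\<in>K. {a. 0 \<le> 1 + a \<bullet> (p - q)})"
      by (intro closed_INT ballI closed_Collect_le continuous_intros)
    ultimately show ?thesis
      by simp
  qed
  ultimately show ?thesis
    by (simp add: compact_eq_bounded_closed)
qed

text \<open>
  The exponential of the logarithmic potential is a product, which is defined and continuous on
  the closed polytope and vanishes on its boundary. It equals \<open>1\<close> at \<open>a = 0\<close>, so it attains its
  maximum in the interior, where the derivative of the logarithm vanishes in every direction.
\<close>

lemma centering_vector_exists:
  fixes K :: "'a::euclidean_space set"
  assumes fin: "finite K" and q: "q \<in> interior (convex hull K)"
  obtains a where "centering_vector K q a"
proof -
  define D where "D = {a. \<forall>p\<in>K. 0 \<le> 1 + a \<bullet> (p - q)}"
  define F where "F a = (\<Prod>p\<in>K. 1 + a \<bullet> (p - q))" for a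
  have "compact D"
    unfolding D_def by (rule compact_nonneg_affine[OF q])
  moreover have "0 \<in> D"
    by (simp add: D_def)
  moreover have "continuous_on D F"
    unfolding F_def by (intro continuous_intros)
  ultimately obtain a where a: "a \<in> D" and max: "\<And>b. b \<in> D \<Longrightarrow> F b \<le> F a"
    using continuous_attains_sup[of D F] by blast
  have "F 0 \<le> F a"
    using \<open>0 \<in> D\<close> by (rule max)
  then have "F a \<noteq> 0"
    by (simp add: F_def)
  with fin a have pos: "0 < 1 + a \<bullet> (p - q)" if "p \<in> K" for p
    using that unfolding F_def D_def by (force simp: less_le)
  have critical: "(\<Sum>p\<in>K. h \<bullet> (p - q) / (1 + a \<bullet> (p - q))) = 0" for h
  proof -
    define G where "G t = (\<Sum>p\<in>K. ln (1 + (a + t *\<^sub>R h) \<bullet> (p - q)))" for t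
    have "eventually (\<lambda>t. 0 < 1 + (a + t *\<^sub>R h) \<bullet> (p - q)) (nhds 0)" if "p \<in> K" for p
    proof -
      have "isCont (\<lambda>t. 1 + (a + t *\<^sub>R h) \<bullet> (p - q)) 0"
        by (intro continuous_intros)
      then have "((\<lambda>t. 1 + (a + t *\<^sub>R h) \<bullet> (p - q)) \<longlongrightarrow> 1 + a \<bullet> (p - q)) (nhds 0)"
        by (simp add: isCont_def tendsto_nhds_iff)
      then show ?thesis
        using pos[OF that] by (rule order_tendstoD)
    qed
    then have "eventually (\<lambda>t. \<forall>p\<in>K. 0 < 1 + (a + t *\<^sub>R h) \<bullet> (p - q)) (nhds 0)"
      using fin by (simp add: eventually_ball_finite_distrib)
    then obtain d where d: "0 < d"
      "\<And>t p. dist t 0 < d \<Longrightarrow> p \<in> K \<Longrightarrow> 0 < 1 + (a + t *\<^sub>R h) \<bullet> (p - q)"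
      unfolding eventually_nhds_metric by blast
    have ln_F: "G t = ln (F (a + t *\<^sub>R h))" if "dist t 0 < d" for t
      unfolding G_def F_def
      by (rule ln_prod [symmetric]) (use fin d(2)[OF that] in \<open>force+\<close>)
    have "G t \<le> G 0" if "\<bar>0 - t\<bar> < d" for t
    proof -
      have t: "dist t 0 < d"
        using that by (simp add: dist_real_def)
      have "a + t *\<^sub>R h \<in> D"
        using d(2)[OF t] by (auto simp: D_def less_imp_le)
      then have "F (a + t *\<^sub>R h) \<le> F a"
        by (rule max)
      moreover have "0 < F (a + t *\<^sub>R h)"
        unfolding F_def using d(2)[OF t] by (intro prod_pos) auto
      ultimately show ?thesis
        using ln_F[OF t] ln_F[of 0] d(1) by simp
    qed
    moreover have "(G has_real_derivative (\<Sum>p\<in>K. h \<bullet> (p - q) / (1 + a \<bullet> (p - q)))) (at 0)"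
      unfolding G_def inner_add_left inner_scaleR_left
      by (rule DERIV_sum)
        (use pos in \<open>auto intro!: derivative_eq_intros simp: divide_simps\<close>)
    ultimately show ?thesis
      using d(1) DERIV_local_max by blast
  qed
  have "h \<bullet> (\<Sum>p\<in>K. (p - q) /\<^sub>R (1 + a \<bullet> (p - q))) = 0" for h
    using critical[of h] by (simp add: inner_sum_right divide_inverse mult.commute)
  then have "(\<Sum>p\<in>K. (p - q) /\<^sub>R (1 + a \<bullet> (p - q))) = 0"
    using inner_eq_zero_iff by blast
  with pos show ?thesis
    by (intro that[of a]) (auto simp: centering_vector_def)
qed

text \<open>
  Strict concavity in the form of monotonicity of the gradient: pairing the difference of the two
  critical point equations with \<open>b - a\<close> makes a sum of squares
  \<open>((b - a) \<bullet> (p - q))\<^sup>2\<close> with positive weights vanish.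
\<close>

lemma centering_vector_unique:
  fixes K :: "'a::euclidean_space set"
  assumes fin: "finite K" and span: "affine hull K = UNIV"
    and a: "centering_vector K q a" and b: "centering_vector K q b"
  shows "a = b"
proof -
  let ?l = "\<lambda>a p. 1 + a \<bullet> (p - q)"
  let ?s = "\<lambda>p. ((b - a) \<bullet> (p - q))\<^sup>2 / (?l a p * ?l b p)"
  have pos: "0 < ?l a p" "0 < ?l b p" if "p \<in> K" for p
    using a b that by (auto simp: centering_vector_def)
  have pair: "(\<Sum>p\<in>K. (b - a) \<bullet> (p - q) / ?l c p) = 0" if "centering_vector K q c" for c
  proof -
    have "(\<Sum>p\<in>K. (b - a) \<bullet> (p - q) / ?l c p) = (b - a) \<bullet> (\<Sum>p\<in>K. (p - q) /\<^sub>R ?l c p)"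
      by (simp add: inner_sum_right divide_inverse mult.commute)
    also have "\<dots> = 0"
      using that by (simp add: centering_vector_def)
    finally show ?thesis .
  qed
  have "(\<Sum>p\<in>K. ?s p) = (\<Sum>p\<in>K. (b - a) \<bullet> (p - q) / ?l a p - (b - a) \<bullet> (p - q) / ?l b p)"
  proof (rule sum.cong[OF refl])
    fix p assume p: "p \<in> K"
    have "(b - a) \<bullet> (p - q) = ?l b p - ?l a p"
      by (simp add: inner_diff_left)
    moreover have "(y - x)\<^sup>2 / (x * y) = (y - x) / x - (y - x) / y" if "0 < x" "0 < y" for x y :: real
      using that by (simp add: power2_eq_square field_simps)
    ultimately show "?s p = (b - a) \<bullet> (p - q) / ?l a p - (b - a) \<bullet> (p - q) / ?l b p"
      using pos[OF p] by presburger
  qed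
  also have "\<dots> = 0"
    using pair[OF a] pair[OF b] by (simp add: sum_subtractf)
  finally have "\<forall>p\<in>K. ?s p = 0"
    using fin pos by (subst (asm) sum_nonneg_eq_0_iff) (auto simp: less_imp_le)
  then have orth: "(b - a) \<bullet> p = (b - a) \<bullet> q" if "p \<in> K" for p
    using pos[OF that] that by (force simp: inner_diff_right)
  \<comment> \<open>\<open>K\<close> lies in a level set of \<open>(\<bullet>) (b - a)\<close>, which is a proper affine subspace unless \<open>a = b\<close>.\<close>
  have "affine hull K \<subseteq> {x. (b - a) \<bullet> x = (b - a) \<bullet> q}"
    using orth by (intro hull_minimal affine_hyperplane) auto
  with span have "(b - a) \<bullet> (q + (b - a)) = (b - a) \<bullet> q"
    by blast
  then show ?thesis
    by (simp add: inner_add_right)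
qed

section \<open>Projective transformations in homogeneous coordinates\<close>

lemma affine_coords_hpoint:
  assumes "x0 \<noteq> 0"
  shows "affine_coords (hpoint (x0, x)) = x /\<^sub>R x0"
proof -
  have "hpoint (x0, x) = affine_embed (x /\<^sub>R x0)"
    using assms by (auto simp: affine_embed_def hpoint_eq_iff zero_prod_def
        intro!: exI[of _ "inverse x0"])
  then show ?thesis
    by (simp add: affine_coords_def inj_affine_embed)
qed

lemma hpoint_in_chart_iff:
  assumes "(x0, x) \<noteq> 0"
  shows "hpoint (x0, x) \<in> range affine_embed \<longleftrightarrow> x0 \<noteq> 0"
  using assms by (auto simp: range_affine_embed hpoint_eq_iff zero_prod_def)

lemma linear_bij_nonzero:
  assumes "linear f" and "bij f" and "v \<noteq> 0"
  shows "f v \<noteq> 0"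
  using assms by (metis bij_pointE linear_0)

lemma projective_transformation_of_linear:
  fixes f :: "real \<times> (real ^ 'd) \<Rightarrow> real \<times> (real ^ 'd)"
  assumes "linear f" and "bij f"
  obtains \<phi> where "projective_transformation \<phi>" "\<And>v. v \<noteq> 0 \<Longrightarrow> \<phi> (hpoint v) = hpoint (f v)"
proof -
  define r where "r P = (SOME v. v \<noteq> 0 \<and> P = hpoint v)" for P :: "'d rproj"
  have r: "r P \<noteq> 0" "hpoint (r P) = P" for P
  proof -
    have "\<exists>v. v \<noteq> 0 \<and> P = hpoint v"
      using hpoint_cases[of P] by metis
    then have "r P \<noteq> 0 \<and> P = hpoint (r P)"
      unfolding r_def by (rule someI_ex)
    then show "r P \<noteq> 0" "hpoint (r P) = P"
      by auto
  qed
  have f_hpoint: "hpoint (f u) = hpoint (f v)"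
    if nz: "u \<noteq> 0" "v \<noteq> 0" and eq: "hpoint u = hpoint v" for u v
  proof -
    obtain c where "c \<noteq> 0" "v = c *\<^sub>R u"
      using eq hpoint_eq_iff[OF nz] by blast
    then show ?thesis
      using linear_bij_nonzero[OF assms nz(1)] linear_bij_nonzero[OF assms nz(2)]
      by (auto simp: hpoint_eq_iff linear_cmul[OF assms(1)])
  qed
  have "hpoint (f (r (hpoint v))) = hpoint (f v)" if "v \<noteq> 0" for v
    by (rule f_hpoint[OF r(1) that r(2)])
  with assms show ?thesis
    by (intro that[of "\<lambda>P. hpoint (f (r P))"]) (auto simp: projective_transformation_def)
qed

lemma chart_image:
  assumes "\<And>v. v \<noteq> 0 \<Longrightarrow> \<phi> (hpoint v) = hpoint (f v)" and "fst (f (1, x)) \<noteq> 0"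
  shows "affine_coords (\<phi> (affine_embed x)) = snd (f (1, x)) /\<^sub>R fst (f (1, x))"
  using assms affine_coords_hpoint[of "fst (f (1, x))" "snd (f (1, x))"]
  by (simp add: affine_embed_def zero_prod_def)

lemma admissible_iff:
  assumes "linear f" and "bij f" and "\<And>v. v \<noteq> 0 \<Longrightarrow> \<phi> (hpoint v) = hpoint (f v)"
  shows "admissible \<phi> K \<longleftrightarrow> (\<forall>x\<in>convex hull K. fst (f (1, x)) \<noteq> 0)"
proof -
  have "\<phi> (affine_embed x) \<in> range affine_embed \<longleftrightarrow> fst (f (1, x)) \<noteq> 0" for x
  proof -
    have nz: "(1, x) \<noteq> (0 :: real \<times> (real ^ 'a))"
      by (simp add: zero_prod_def)
    then have "f (1, x) \<noteq> 0"
      by (rule linear_bij_nonzero[OF assms(1,2)])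
    then have "hpoint (f (1, x)) \<in> range affine_embed \<longleftrightarrow> fst (f (1, x)) \<noteq> 0"
      using hpoint_in_chart_iff[of "fst (f (1, x))" "snd (f (1, x))"] by simp
    then show ?thesis
      using assms(3)[OF nz] by (simp add: affine_embed_def)
  qed
  then show ?thesis
    by (auto simp: admissible_def image_subset_iff)
qed

text \<open>
  If \<open>h\<close> multiplies the coordinate \<open>x\<^sub>0\<close> by a constant, then it preserves the hyperplane at
  infinity \<open>x\<^sub>0 = 0\<close>, and its blocks on \<open>(0, x)\<close> and \<open>(1, 0)\<close> are the matrix and the translation.
\<close>

lemma affine_transformation_if_fst_scaled:
  fixes h :: "real \<times> (real ^ 'd) \<Rightarrow> real \<times> (real ^ 'd)"
  assumes lin: "linear h" and bij: "bij h"
    and \<phi>: "\<And>v. v \<noteq> 0 \<Longrightarrow> \<phi> (hpoint v) = hpoint (h v)"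
    and fst_h: "\<And>v. fst (h v) = k * fst v" and k: "k \<noteq> 0"
  shows "affine_transformation \<phi>"
proof -
  define L where "L x = snd (h (0, x)) /\<^sub>R k" for x
  define b where "b = snd (h (1, 0)) /\<^sub>R k"
  have "linear L"
  proof (rule linearI)
    fix x y :: "real ^ 'd" and c :: real
    have "h (0, x + y) = h (0, x) + h (0, y)"
      using linear_add[OF lin, of "(0, x)" "(0, y)"] by simp
    then show "L (x + y) = L x + L y"
      by (simp add: L_def scaleR_add_right)
    have "h (0, c *\<^sub>R x) = c *\<^sub>R h (0, x)"
      using linear_cmul[OF lin, of c "(0, x)"] by simp
    then show "L (c *\<^sub>R x) = c *\<^sub>R L x"
      by (simp add: L_def mult.commute)
  qed
  moreover have "inj L"
  proof (rule injI)
    fix x y assume "L x = L y"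
    then have "h (0, x) = h (0, y)"
      using k fst_h by (simp add: L_def prod_eq_iff)
    with bij show "x = y"
      by (auto dest: bij_is_inj injD)
  qed
  ultimately have "invertible (matrix L)" "matrix L *v x = L x" for x
    by (auto simp: matrix_invertible matrix_works linear_injective_left_inverse
        invertible_left_inverse matrix_left_invertible_injective)
  moreover have "\<phi> (affine_embed x) = affine_embed (L x + b)" for x
  proof -
    have "h (1, x) = h (0, x) + h (1, 0)"
      using linear_add[OF lin, of "(0, x)" "(1, 0)"] by simp
    then have "h (1, x) = k *\<^sub>R (1, L x + b)"
      using k fst_h[of "(1, x)"] by (simp add: prod_eq_iff L_def b_def scaleR_add_right)
    moreover have "hpoint (k *\<^sub>R (1, L x + b)) = hpoint (1, L x + b)"
      using k by (subst eq_commute, subst hpoint_eq_iff) (auto simp: zero_prod_def)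
    ultimately show ?thesis
      using \<phi>[of "(1, x)"] by (simp add: affine_embed_def zero_prod_def)
  qed
  ultimately show ?thesis
    unfolding affine_transformation_def projective_transformation_def
    using lin bij \<phi> by metis
qed

section \<open>Transformations with a prescribed centroid\<close>

text \<open>
  The vector \<open>b\<close> is the gradient of the denominator \<open>\<lambda>x. fst (g (1, x))\<close> normalised to \<open>1\<close> at
  \<open>q\<close>. The centroid equation is an equation between images under \<open>g\<close> of vectors of
  \<open>\<real> \<times> \<real>\<^sup>d\<close>, so injectivity of \<open>g\<close> removes all dependence on the numerator.
\<close>

lemma centering_vector_of_centroid:
  fixes g :: "real \<times> (real ^ 'd) \<Rightarrow> real \<times> (real ^ 'd)"
  assumes lin: "linear g" and bij: "bij g"
    and fin: "finite K" and q: "q \<in> convex hull K"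
    and nz: "\<And>x. x \<in> convex hull K \<Longrightarrow> fst (g (1, x)) \<noteq> 0"
    and cen: "(\<Sum>p\<in>K. snd (g (1, p)) /\<^sub>R fst (g (1, p))) /\<^sub>R real (card K)
                = snd (g (1, q)) /\<^sub>R fst (g (1, q))"
  obtains b where "centering_vector K q b"
    "\<And>v. fst (g v) = fst (g (1, q)) * (fst v + b \<bullet> (snd v - fst v *\<^sub>R q))"
proof -
  define m where "m x = fst (g (1, x))" for x
  define L where "L x = fst (g (0, x)) / m q" for x
  have m_q: "m q \<noteq> 0"
    using nz q by (simp add: m_def)
  have "linear L"
  proof (rule linearI)
    fix x y :: "real ^ 'd" and c :: real
    show "L (x + y) = L x + L y"
      using linear_add[OF lin, of "(0, x)" "(0, y)"] by (simp add: L_def add_divide_distrib)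
    show "L (c *\<^sub>R x) = c *\<^sub>R L x"
      using linear_cmul[OF lin, of c "(0, x)"] by (simp add: L_def)
  qed
  define b where "b = adjoint L 1"
  have b: "b \<bullet> x = L x" for x
    using adjoint_works[OF \<open>linear L\<close>, of x 1] by (simp add: b_def inner_commute)
  have fst_g: "fst (g v) = m q * (fst v + b \<bullet> (snd v - fst v *\<^sub>R q))" for v
  proof -
    define w where "w = snd v - fst v *\<^sub>R q"
    have "v = fst v *\<^sub>R (1, q) + (0, w)"
      by (simp add: prod_eq_iff w_def)
    then have "g v = fst v *\<^sub>R g (1, q) + g (0, w)"
      using linear_add[OF lin] linear_cmul[OF lin] by metis
    then have "fst (g v) = fst v * m q + fst (g (0, w))"
      by (simp add: m_def)
    moreover have "fst (g (0, w)) = m q * (b \<bullet> w)"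
      using m_q by (simp add: b L_def)
    ultimately show ?thesis
      by (simp add: w_def distrib_left mult.commute)
  qed
  have m: "m x = m q * (1 + b \<bullet> (x - q))" for x
    using fst_g[of "(1, x)"] by (simp add: m_def)
  have pos: "0 < 1 + b \<bullet> (p - q)" if p: "p \<in> K" for p
  proof (rule ccontr)
    assume "\<not> 0 < 1 + b \<bullet> (p - q)"
    \<comment> \<open>Otherwise the denominator vanishes at a point between \<open>q\<close> and \<open>p\<close>.\<close>
    then have neg: "b \<bullet> (p - q) \<le> -1"
      by simp
    define t where "t = - 1 / (b \<bullet> (p - q))"
    have "0 \<le> t" "t \<le> 1"
      using neg by (auto simp: t_def divide_simps)
    then have "(1 - t) *\<^sub>R q + t *\<^sub>R p \<in> convex hull K"
      using q p by (intro convexD[OF convex_convex_hull]) (auto intro: hull_inc)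
    then have "m ((1 - t) *\<^sub>R q + t *\<^sub>R p) \<noteq> 0"
      using nz by (simp add: m_def)
    moreover have "(1 - t) *\<^sub>R q + t *\<^sub>R p - q = t *\<^sub>R (p - q)"
      by (simp add: algebra_simps)
    moreover have "1 + t * (b \<bullet> (p - q)) = 0"
      using neg by (simp add: t_def)
    ultimately show False
      using m[of "(1 - t) *\<^sub>R q + t *\<^sub>R p"] by simp
  qed
  have m_K: "m p \<noteq> 0" if "p \<in> K" for p
    using nz that by (simp add: m_def hull_inc)
  have card: "real (card K) \<noteq> 0"
    using fin q by auto
  have "g (\<Sum>p\<in>K. (1, p) /\<^sub>R m p) = (\<Sum>p\<in>K. g (1, p) /\<^sub>R m p)"
    by (simp only: linear_sum[OF lin] linear_cmul[OF lin])
  also have "\<dots> = (real (card K) / m q) *\<^sub>R g (1, q)"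
  proof (rule prod_eqI)
    have "fst (\<Sum>p\<in>K. g (1, p) /\<^sub>R m p) = (\<Sum>p\<in>K. inverse (m p) * m p)"
      by (simp add: fst_sum m_def)
    also have "\<dots> = (\<Sum>p\<in>K. 1)"
      using m_K by (intro sum.cong) auto
    also have "\<dots> = real (card K) / m q * m q"
      using m_q by simp
    finally show "fst (\<Sum>p\<in>K. g (1, p) /\<^sub>R m p) = fst ((real (card K) / m q) *\<^sub>R g (1, q))"
      by (simp add: m_def)
    have "(\<Sum>p\<in>K. snd (g (1, p)) /\<^sub>R m p)
        = real (card K) *\<^sub>R ((\<Sum>p\<in>K. snd (g (1, p)) /\<^sub>R m p) /\<^sub>R real (card K))"
      using card by simp
    also have "\<dots> = real (card K) *\<^sub>R (snd (g (1, q)) /\<^sub>R m q)"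
      using cen by (simp only: m_def)
    finally show "snd (\<Sum>p\<in>K. g (1, p) /\<^sub>R m p) = snd ((real (card K) / m q) *\<^sub>R g (1, q))"
      by (simp add: snd_sum divide_inverse)
  qed
  also have "\<dots> = g ((real (card K) / m q) *\<^sub>R (1, q))"
    by (simp only: linear_cmul[OF lin])
  finally have eq: "(\<Sum>p\<in>K. (1 :: real, p) /\<^sub>R m p) = (real (card K) / m q) *\<^sub>R (1, q)"
    by (rule injD[OF bij_is_inj[OF bij]])
  have sum_1: "(\<Sum>p\<in>K. inverse (m p)) = real (card K) / m q"
    using arg_cong[OF eq, of fst] by (simp add: fst_sum)
  have sum_p: "(\<Sum>p\<in>K. p /\<^sub>R m p) = (real (card K) / m q) *\<^sub>R q"
    using arg_cong[OF eq, of snd] by (simp add: snd_sum)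
  have "(\<Sum>p\<in>K. (p - q) /\<^sub>R m p) = 0"
    using sum_1 sum_p by (simp add: scaleR_diff_right sum_subtractf flip: scaleR_sum_left)
  moreover have "(\<Sum>p\<in>K. (p - q) /\<^sub>R (1 + b \<bullet> (p - q))) = m q *\<^sub>R (\<Sum>p\<in>K. (p - q) /\<^sub>R m p)"
    unfolding scaleR_sum_right
  proof (rule sum.cong[OF refl])
    fix p
    have "inverse (1 + b \<bullet> (p - q)) = m q * inverse (m p)"
      using m_q by (subst m[of p]) simp
    then show "(p - q) /\<^sub>R (1 + b \<bullet> (p - q)) = m q *\<^sub>R ((p - q) /\<^sub>R m p)"
      by simp
  qed
  ultimately have "centering_vector K q b"
    using pos by (simp add: centering_vector_def)
  then show ?thesis
    using that[OF _ fst_g[unfolded m_def]] by simp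
qed

text \<open>
  The map sends \<open>q\<close> to the origin of the chart and \<open>x\<close> to \<open>(x - q) /\<^sub>R (1 + a \<bullet> (x - q))\<close>.
\<close>

definition centering_map :: "real ^ 'd \<Rightarrow> real ^ 'd \<Rightarrow> real \<times> (real ^ 'd) \<Rightarrow> real \<times> (real ^ 'd)"
  where "centering_map q a v =
    (fst v + a \<bullet> (snd v - fst v *\<^sub>R q), snd v - fst v *\<^sub>R q)"

lemma linear_centering_map: "linear (centering_map q a)"
  by (rule linearI) (auto simp: centering_map_def algebra_simps inner_add_right inner_diff_right)

lemma bij_centering_map: "bij (centering_map q a)"
  by (rule bij_betw_byWitness[where f' =
        "\<lambda>w. (fst w - a \<bullet> snd w, snd w + (fst w - a \<bullet> snd w) *\<^sub>R q)"])
    (auto simp: centering_map_def)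

theorem theorem1:
  fixes K :: "(real ^ 'd) set" and q :: "real ^ 'd"
  assumes "finite K"
    and "affine hull K = UNIV"
    and "q \<in> interior (convex hull K)"
  shows "\<exists>\<phi> :: 'd rproj \<Rightarrow> 'd rproj.
    projective_transformation \<phi> \<and> admissible \<phi> K \<and>
    (\<Sum>p\<in>K. affine_coords (\<phi> (affine_embed p))) /\<^sub>R real (card K) = affine_coords (\<phi> (affine_embed q)) \<and>
    (\<forall>\<psi>. projective_transformation \<psi> \<and> admissible \<psi> K \<and>
         (\<Sum>p\<in>K. affine_coords (\<psi> (affine_embed p))) /\<^sub>R real (card K) = affine_coords (\<psi> (affine_embed q))
         \<longrightarrow> affine_transformation (\<phi> \<circ> inv \<psi>))"
proof -
  have q: "q \<in> convex hull K"
    using assms(3) interior_subset by blast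
  obtain a where a: "centering_vector K q a"
    using centering_vector_exists[OF assms(1,3)] .
  define f where "f = centering_map q a"
  have f: "linear f" "bij f"
    by (auto simp: f_def linear_centering_map bij_centering_map)
  obtain \<phi> where proj: "projective_transformation \<phi>"
    and \<phi>: "\<And>v. v \<noteq> 0 \<Longrightarrow> \<phi> (hpoint v) = hpoint (f v)"
    using projective_transformation_of_linear[OF f] by blast
  have pos: "0 < 1 + a \<bullet> (x - q)" if "x \<in> convex hull K" for x
    by (rule affine_pos_on_hull[OF assms(1) _ that]) (use a in \<open>simp add: centering_vector_def\<close>)
  have f_1: "f (1, x) = (1 + a \<bullet> (x - q), x - q)" for x
    by (simp add: f_def centering_map_def)
  have adm: "admissible \<phi> K"
    using pos by (subst admissible_iff[OF f \<phi>]) (force simp: f_1)+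
  have img: "affine_coords (\<phi> (affine_embed x)) = (x - q) /\<^sub>R (1 + a \<bullet> (x - q))"
    if "x \<in> convex hull K" for x
    using chart_image[of \<phi> f x, OF \<phi>] pos[OF that] by (simp add: f_1)
  have "(\<Sum>p\<in>K. affine_coords (\<phi> (affine_embed p))) = 0"
    using a by (simp add: img hull_inc centering_vector_def)
  then have cen: "(\<Sum>p\<in>K. affine_coords (\<phi> (affine_embed p))) /\<^sub>R real (card K)
      = affine_coords (\<phi> (affine_embed q))"
    by (simp add: img[OF q])
  have "affine_transformation (\<phi> \<circ> inv \<psi>)"
    if \<psi>_proj: "projective_transformation \<psi>" and \<psi>_adm: "admissible \<psi> K"
      and \<psi>_cen: "(\<Sum>p\<in>K. affine_coords (\<psi> (affine_embed p))) /\<^sub>R real (card K)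
        = affine_coords (\<psi> (affine_embed q))" for \<psi>
  proof -
    obtain g where g: "linear g" "bij g" and \<psi>: "\<And>v. v \<noteq> 0 \<Longrightarrow> \<psi> (hpoint v) = hpoint (g v)"
      using \<psi>_proj by (auto simp: projective_transformation_def)
    have nz: "fst (g (1, x)) \<noteq> 0" if "x \<in> convex hull K" for x
      using \<psi>_adm that admissible_iff[OF g \<psi>] by blast
    have "affine_coords (\<psi> (affine_embed x)) = snd (g (1, x)) /\<^sub>R fst (g (1, x))"
      if "x \<in> convex hull K" for x
      using chart_image[of \<psi> g x, OF \<psi>] nz[OF that] by simp
    then have "(\<Sum>p\<in>K. snd (g (1, p)) /\<^sub>R fst (g (1, p))) /\<^sub>R real (card K)
        = snd (g (1, q)) /\<^sub>R fst (g (1, q))"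
      using \<psi>_cen q by (simp add: hull_inc)
    then obtain b where b: "centering_vector K q b"
      and fst_g: "\<And>v. fst (g v) = fst (g (1, q)) * (fst v + b \<bullet> (snd v - fst v *\<^sub>R q))"
      using centering_vector_of_centroid[OF g assms(1) q nz] by metis
    have "b = a"
      using centering_vector_unique[OF assms(1,2) b a] .
    then have fst_gf: "fst (g v) = fst (g (1, q)) * fst (f v)" for v
      using fst_g[of v] by (simp add: f_def centering_map_def)
    define h where "h = f \<circ> inv g"
    have g_inv: "g (inv g w) = w" for w
      using g(2) by (simp add: bij_is_surj surj_f_inv_f)
    have inv_g: "linear (inv g)" "bij (inv g)"
      using g by (auto simp: bij_imp_bij_inv bij_is_inj intro!: inj_linear_imp_inv_linear)
    then have "linear h" "bij h"
      using f by (auto simp: h_def intro: linear_compose bij_comp)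
    moreover have "(\<phi> \<circ> inv \<psi>) (hpoint w) = hpoint (h w)" if "w \<noteq> 0" for w
    proof -
      have v: "inv g w \<noteq> 0"
        using linear_bij_nonzero[OF inv_g that] .
      then have "\<psi> (hpoint (inv g w)) = hpoint w"
        by (simp add: \<psi> g_inv)
      then have "inv \<psi> (hpoint w) = hpoint (inv g w)"
        using bij_projective_transformation[OF \<psi>_proj] by (metis bij_inv_eq_iff)
      then show ?thesis
        using \<phi>[OF v] by (simp add: h_def)
    qed
    moreover have "fst (h w) = inverse (fst (g (1, q))) * fst w" for w
      using fst_gf[of "inv g w"] nz[OF q] by (simp add: h_def g_inv)
    moreover have "inverse (fst (g (1, q))) \<noteq> 0"
      using nz[OF q] by (rule nonzero_imp_inverse_nonzero)
    ultimately show ?thesis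
      by (rule affine_transformation_if_fst_scaled)
  qed
  with proj adm cen show ?thesis
    by blast
qed

end
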